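(* Let $\{G_n\}_{n\ge1}$ be a sequence of random undirected (multi)graphs, $G_n$ having $n$ nodes, satisfying the following two assumptions. (1) There exist a probability density $f$ on the non-negative integers with size-biased version $f^*$ and some $\alpha,\varepsilon>0$ such that, with $\Omega_n=\{\max\{d_1(f_n,f),d_1(f_n^*,f^* )\}\le n^{-\varepsilon}\}$, we have $\mathbb{P}(\Omega_n^c)=O(n^{-\alpha})$ as $n\to\infty$. (2) There exist a joint probability density function $h(k,\ell)$ on the positive integers and some $\kappa>0$ such that, with $$\Gamma_n=\left\{\sum_{k,\ell=1}^\infty|h_n(k,\ell)-h(k,\ell)|\,\mathbf{1}\{f_n(k)>0\}\le n^{-\kappa}\right\},$$ we have $\lim_{n\to\infty}\mathbb{P}(\Gamma_n)=1$. Assume moreover that the limiting distribution $f$ has a finite $(2+\eta)$-moment for some $0<\eta<1$. Then, for each fixed $k$ such that $f(k)>0$ and each $0<\delta<\min\{\varepsilon,\frac{\kappa\eta}{\eta+1}\}$, $$\lim_{n\to\infty}\mathbb{P}\left(|\Phi_n(k)-\Phi(k)|\le n^{-\delta}\right)=1,$$ where $\Phi_n(k)$ is the average nearest neighbor degree in $G_n$ and $$\Phi(k)=\mathbf{1}\{f^*(k)>0\}\,\frac{\sum_{\ell=1}^\infty h(k,\ell)\,\ell}{f^*(k)}.$$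
   Context: Let $G_n$ be an undirected (multi)graph with nodes $1,\dots,n$. Each undirected edge between $i$ and $j$ is replaced by two directed edges $i\to j$ and $j\to i$; $G_{ij}$ denotes the number of edges $i\to j$ (so $G_{ij}=G_{ji}$, and $G_{ii}$ is twice the number of self-loops at $i$). The degree of node $i$ is $D_i=\sum_{j=1}^nG_{ij}$, and $L_n=\sum_{i=1}^nD_i$. The sum $\sum_{i\to j}$ is over all directed edges, with multiplicity. Empirical densities: $f_n(k)=\frac1n\sum_{i=1}^n\mathbf{1}\{D_i=k\}$, $f_n^*(k)=\frac1{L_n}\sum_{i=1}^nk\,\mathbf{1}\{D_i=k\}$, and the joint degree distribution $h_n(k,\ell)=\frac1{L_n}\sum_{i\to j}\mathbf{1}\{D_i=k,D_j=\ell\}=\frac{1}{L_n}\sum_{i,j=1}^n G_{ij}\mathbf{1}\{D_i=k,D_j=\ell\}$. The average nearest neighbor degree (ANND) is $\Phi_n(k)=\mathbf{1}\{f_n(k)>0\}\,\frac{\sum_{\ell>0}h_n(k,\ell)\ell}{f_n^*(k)}$ (set to $0$ if $f_n(k)=0$). The size-biased version of $f$ is $f^*(k)=kf(k)/\sum_{j}jf(j)$. For densities $p,q$ on the non-negative integers with distribution functions $P,Q$, $d_1(p,q)=\sum_{k\ge0}|P(k)-Q(k)|$. *)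

theory Defs
  imports "HOL-Probability.Probability" "HOL-Library.Uprod" "HOL-Library.Landau_Symbols"
begin

text \<open>A multigraph is given by the multiset of its undirected edges; an edge is an unordered
  pair of nodes, and \<open>Upair i i\<close> is a self-loop at \<open>i\<close>.\<close>

type_synonym multigraph = "nat uprod multiset"

definition multigraph_on :: "nat \<Rightarrow> multigraph \<Rightarrow> bool" where
  "multigraph_on n E \<longleftrightarrow> (\<forall>e\<in>#E. set_uprod e \<subseteq> {1..n})"

text \<open>The number of directed edges from \<open>i\<close> to \<open>j\<close> after each undirected edge between \<open>i\<close> and \<open>j\<close>
  has been replaced by \<open>i \<rightarrow> j\<close> and \<open>j \<rightarrow> i\<close>; hence a self-loop counts twice.\<close>

definition arcs :: "multigraph \<Rightarrow> nat \<Rightarrow> nat \<Rightarrow> nat" where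
  "arcs E i j = (if i = j then 2 * count E (Upair i i) else count E (Upair i j))"

definition deg :: "nat \<Rightarrow> multigraph \<Rightarrow> nat \<Rightarrow> nat" where
  "deg n E i = (\<Sum>j=1..n. arcs E i j)"

definition total_deg :: "nat \<Rightarrow> multigraph \<Rightarrow> nat" where
  "total_deg n E = (\<Sum>i=1..n. deg n E i)"

text \<open>The empirical densities \<open>f\<^sub>n\<close>, \<open>f\<^sub>n\<^sup>*\<close> and \<open>h\<^sub>n\<close>. The latter two vanish identically
  if the graph has no edges.\<close>

definition emp_deg :: "nat \<Rightarrow> multigraph \<Rightarrow> nat \<Rightarrow> real" where
  "emp_deg n E k = (\<Sum>i=1..n. of_bool (deg n E i = k)) / real n"

definition emp_deg_sb :: "nat \<Rightarrow> multigraph \<Rightarrow> nat \<Rightarrow> real" where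
  "emp_deg_sb n E k = (\<Sum>i=1..n. real k * of_bool (deg n E i = k)) / real (total_deg n E)"

definition emp_joint :: "nat \<Rightarrow> multigraph \<Rightarrow> nat \<Rightarrow> nat \<Rightarrow> real" where
  "emp_joint n E k l =
     (\<Sum>i=1..n. \<Sum>j=1..n. real (arcs E i j) * of_bool (deg n E i = k \<and> deg n E j = l))
       / real (total_deg n E)"

text \<open>The average nearest neighbour degree. The sum over \<open>l\<close> has finitely many nonzero terms.
  For \<open>k = 0\<close> the quotient reads \<open>0 / 0 = 0\<close>.\<close>

definition annd :: "nat \<Rightarrow> multigraph \<Rightarrow> nat \<Rightarrow> real" where
  "annd n E k = of_bool (emp_deg n E k > 0) *
     ((\<Sum>\<^sub>\<infinity>l\<in>{1..}. emp_joint n E k l * real l) / emp_deg_sb n E k)"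

text \<open>Meaningful only if \<open>p\<close> has a finite, positive mean.\<close>

definition size_biased :: "(nat \<Rightarrow> real) \<Rightarrow> nat \<Rightarrow> real" where
  "size_biased p k = real k * p k / (\<Sum>j. real j * p j)"

text \<open>The distance \<open>d\<^sub>1\<close> takes values in \<open>[0, \<infinity>]\<close>, so that a divergent sum is never small.\<close>

definition d1 :: "(nat \<Rightarrow> real) \<Rightarrow> (nat \<Rightarrow> real) \<Rightarrow> ennreal" where
  "d1 p q = (\<Sum>k. ennreal \<bar>(\<Sum>j\<le>k. p j) - (\<Sum>j\<le>k. q j)\<bar>)"

definition limit_annd :: "nat pmf \<Rightarrow> (nat \<times> nat) pmf \<Rightarrow> nat \<Rightarrow> real" where
  "limit_annd f h k = of_bool (size_biased (pmf f) k > 0) *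
     ((\<Sum>\<^sub>\<infinity>l\<in>{1..}. pmf h (k, l) * real l) / size_biased (pmf f) k)"

text \<open>The conditions on a graph with \<open>n\<close> nodes that define the events \<open>\<Omega>\<^sub>n\<close> and \<open>\<Gamma>\<^sub>n\<close>.\<close>

definition deg_close :: "nat pmf \<Rightarrow> real \<Rightarrow> nat \<Rightarrow> multigraph \<Rightarrow> bool" where
  "deg_close f \<epsilon> n E \<longleftrightarrow>
     max (d1 (emp_deg n E) (pmf f)) (d1 (emp_deg_sb n E) (size_biased (pmf f)))
       \<le> ennreal (real n powr (- \<epsilon>))"

definition joint_close :: "(nat \<times> nat) pmf \<Rightarrow> real \<Rightarrow> nat \<Rightarrow> multigraph \<Rightarrow> bool" where
  "joint_close h \<kappa> n E \<longleftrightarrow>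
     (\<Sum>\<^sub>\<infinity>(k, l)\<in>{1..} \<times> {1..}.
        \<bar>emp_joint n E k l - pmf h (k, l)\<bar> * of_bool (emp_deg n E k > 0))
       \<le> real n powr (- \<kappa>)"

end

theory Submission
  imports Defs
begin

text \<open>Work on graphs in \<open>\<Omega>\<^sub>n \<inter> \<Gamma>\<^sub>n\<close>. By symmetry of the arcs, \<open>h\<^sub>n(k, l) \<le> f\<^sub>n\<^sup>*(l)\<close>, and passing to the
  limit along such graphs gives \<open>h(k, l) \<le> f\<^sup>*(l)\<close>, where \<open>f\<^sup>*\<close> has a finite \<open>(1 + \<eta>)\<close>-moment. In the
  difference of the numerators of \<open>\<Phi>\<^sub>n(k)\<close> and \<open>\<Phi>(k)\<close> cut the sum over \<open>l\<close> at \<open>2 a\<close>: the head is at most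
  \<open>2 a n\<^sup>-\<^sup>\<kappa>\<close>, the tail is of order \<open>n\<^sup>-\<^sup>\<epsilon> + a\<^sup>-\<^sup>\<eta>\<close>. The choice \<open>a \<approx> n\<^bsup>\<kappa>/(\<eta>+1)\<^esup>\<close> balances the powers of \<open>a\<close>.\<close>

section \<open>Partial sums of densities, the distance \<open>d1\<close>, and tails of
  moments\<close>

lemma sum_abs_cdf_le:
  assumes "d1 p q \<le> ennreal e" "0 \<le> e" "finite F"
  shows "(\<Sum>m\<in>F. \<bar>sum p {..m} - sum q {..m}\<bar>) \<le> e"
proof -
  have "ennreal (\<Sum>m\<in>F. \<bar>sum p {..m} - sum q {..m}\<bar>)
      = (\<Sum>m\<in>F. ennreal \<bar>sum p {..m} - sum q {..m}\<bar>)"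
    by simp
  also have "\<dots> \<le> d1 p q"
    unfolding d1_def using assms(3) by (intro sum_le_suminf) auto
  finally show ?thesis
    using assms by (meson ennreal_le_iff order_trans)
qed

text \<open>A density at \<open>k\<close> is the increment of its partial sums from
  \<open>k - 1\<close> to \<open>k\<close>. The two errors involved are distinct terms of the series
  \<open>d1\<close>, so together they cost only one \<open>e\<close>.\<close>

lemma density_diff_le:
  assumes "d1 p q \<le> ennreal e" "0 \<le> e" "1 \<le> k"
  shows "\<bar>p k - q k\<bar> \<le> e"
proof -
  obtain j where k: "k = Suc j"
    using assms(3) by (cases k) auto
  have "(\<Sum>m\<in>{j, k}. \<bar>sum p {..m} - sum q {..m}\<bar>) \<le> e"
    using assms by (intro sum_abs_cdf_le) auto
  then show ?thesis
    by (simp add: k)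
qed

text \<open>Summation by parts: the truncated difference \<open>l - a\<close> counts the
  \<open>m\<close> with \<open>a \<le> m < l\<close>, and the two sums are exchanged. This turns an
  expected excess over \<open>a\<close> into partial sums, which is what \<open>d1\<close>
  measures.\<close>

lemma sum_excess_eq:
  fixes p :: "nat \<Rightarrow> real"
  shows "(\<Sum>l\<le>N. real (l - a) * p l) = (\<Sum>m=a..<N. sum p {..N} - sum p {..m})"
proof (induction N)
  case (Suc N)
  show ?case
  proof (cases "a \<le> N")
    case True
    \<comment> \<open>Each of the \<open>N - a\<close> old terms grows by \<open>p (Suc N)\<close>,
      and the new term \<open>m = N\<close> equals \<open>p (Suc N)\<close>.\<close>
    have "(\<Sum>m=a..<Suc N. sum p {..Suc N} - sum p {..m})
        = (\<Sum>m=a..<N. (sum p {..N} - sum p {..m}) + p (Suc N)) + p (Suc N)"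
      using True by (simp add: algebra_simps)
    also have "\<dots> = (\<Sum>m=a..<N. sum p {..N} - sum p {..m}) + real (N - a) * p (Suc N) + p (Suc N)"
      unfolding sum.distrib by simp
    also have "\<dots> = (\<Sum>l\<le>Suc N. real (l - a) * p l)"
      unfolding Suc.IH[symmetric] using True by (simp add: Suc_diff_le algebra_simps)
    finally show ?thesis by simp
  next
    case False
    then show ?thesis by simp
  qed
qed simp

text \<open>Markov-type bound: in \<open>l = l powr (-\<eta>) * l powr (1 + \<eta>)\<close> the
  first factor decreases in \<open>l\<close>.\<close>

lemma le_powr_moment:
  fixes a l :: nat and \<eta> :: real
  assumes "1 \<le> a" "0 < \<eta>" "a \<le> l"
  shows "real l \<le> real a powr (-\<eta>) * real l powr (1 + \<eta>)"
proof -
  have "real l powr (-\<eta>) \<le> real a powr (-\<eta>)"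
    using assms by (intro powr_mono2') auto
  then have "real l powr (-\<eta>) * real l powr (1 + \<eta>) \<le> real a powr (-\<eta>) * real l powr (1 + \<eta>)"
    by (intro mult_right_mono) auto
  then show ?thesis
    using assms by (simp flip: powr_add)
qed

lemma sum_moment_tail_le:
  fixes q :: "nat \<Rightarrow> real"
  assumes q: "\<And>l. 0 \<le> q l" "(\<lambda>l. real l powr (1 + \<eta>) * q l) sums C"
    and "0 < \<eta>" "1 \<le> a" "finite F" "F \<subseteq> {a..}"
  shows "(\<Sum>l\<in>F. real l * q l) \<le> real a powr (-\<eta>) * C"
proof -
  have "(\<Sum>l\<in>F. real l * q l) \<le> (\<Sum>l\<in>F. real a powr (-\<eta>) * (real l powr (1 + \<eta>) * q l))"
  proof (intro sum_mono)
    fix l assume "l \<in> F"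
    with assms have "real l * q l \<le> (real a powr (-\<eta>) * real l powr (1 + \<eta>)) * q l"
      by (intro mult_right_mono le_powr_moment) auto
    then show "real l * q l \<le> real a powr (-\<eta>) * (real l powr (1 + \<eta>) * q l)"
      by (simp add: mult.assoc)
  qed
  also have "\<dots> = real a powr (-\<eta>) * (\<Sum>l\<in>F. real l powr (1 + \<eta>) * q l)"
    by (simp add: sum_distrib_left)
  also have "\<dots> \<le> real a powr (-\<eta>) * C"
    using q assms(5) by (intro mult_left_mono) (auto simp: sums_iff intro!: sum_le_suminf)
  finally show ?thesis .
qed

text \<open>For \<open>X\<close> with density \<open>q\<close>, the sum of P(X > m) over
  \<open>m \<ge> a\<close> is the expected excess of \<open>X\<close> over \<open>a\<close>, which
  the tail of the first moment dominates.\<close>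

lemma sum_cdf_tail_le:
  fixes q :: "nat \<Rightarrow> real"
  assumes q: "\<And>l. 0 \<le> q l" "q sums 1" "(\<lambda>l. real l powr (1 + \<eta>) * q l) sums C"
    and "0 < \<eta>" "1 \<le> a"
  shows "(\<Sum>m=a..<N. 1 - sum q {..m}) \<le> real a powr (-\<eta>) * C"
proof (rule LIMSEQ_le_const2)
  \<comment> \<open>The total mass 1 is replaced by the partial sum up to \<open>K\<close>, so that
    the finite identity \<open>sum_excess_eq\<close> applies before \<open>K\<close> tends to
    infinity.\<close>
  show "(\<lambda>K. \<Sum>m=a..<N. sum q {..K} - sum q {..m}) \<longlonglongrightarrow> (\<Sum>m=a..<N. 1 - sum q {..m})"
    using q(2) by (intro tendsto_intros) (simp add: sums_def_le)
  have "(\<Sum>m=a..<N. sum q {..K} - sum q {..m}) \<le> real a powr (-\<eta>) * C" if "N \<le> K" for K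
  proof -
    have "(\<Sum>m=a..<N. sum q {..K} - sum q {..m}) \<le> (\<Sum>m=a..<K. sum q {..K} - sum q {..m})"
      using that q(1) by (intro sum_mono2) (auto intro!: sum_mono2)
    also have "\<dots> = (\<Sum>l\<le>K. real (l - a) * q l)"
      by (simp add: sum_excess_eq)
    also have "\<dots> = (\<Sum>l\<in>{a..K}. real (l - a) * q l)"
      by (intro sum.mono_neutral_right) auto
    also have "\<dots> \<le> (\<Sum>l\<in>{a..K}. real l * q l)"
      using q(1) by (intro sum_mono mult_right_mono) auto
    also have "\<dots> \<le> real a powr (-\<eta>) * C"
      using q assms by (intro sum_moment_tail_le) auto
    finally show ?thesis .
  qed
  then show "\<exists>K. \<forall>n\<ge>K. (\<Sum>m=a..<N. sum q {..n} - sum q {..m}) \<le> real a powr (-\<eta>) * C"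
    by blast
qed

text \<open>Since \<open>l \<le> 2 (l - a)\<close> for \<open>l > 2 a\<close>, the tail is controlled by the 1-Lipschitz function
  \<open>max 0 (l - a)\<close>, whose expectation moves by at most \<open>d\<^sub>1\<close>. Comparing the functions
  \<open>l \<mapsto> l 1{l > a}\<close> directly would lose a factor \<open>a\<close>.\<close>

lemma sum_tail_le_of_d1:
  fixes p q :: "nat \<Rightarrow> real"
  assumes q: "\<And>l. 0 \<le> q l" "q sums 1" "(\<lambda>l. real l powr (1 + \<eta>) * q l) sums C"
    and p: "\<And>l. 0 \<le> p l" "\<And>N. sum p {..N} \<le> 1"
    and d: "d1 p q \<le> ennreal e" "0 \<le> e"
    and "0 < \<eta>" "1 \<le> a" "finite F" "F \<subseteq> {2 * a<..}"
  shows "(\<Sum>l\<in>F. real l * p l) \<le> 2 * (e + real a powr (-\<eta>) * C)"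
proof -
  obtain N where N: "F \<subseteq> {..N}"
    using \<open>finite F\<close> finite_nat_iff_bounded_le by blast
  have "(\<Sum>l\<in>F. real l * p l) \<le> (\<Sum>l\<in>F. 2 * (real (l - a) * p l))"
  proof (intro sum_mono)
    fix l assume "l \<in> F"
    with assms have "2 * a < l" by auto
    then have "real l \<le> 2 * real (l - a)" by linarith
    then have "real l * p l \<le> (2 * real (l - a)) * p l"
      using p(1) by (intro mult_right_mono) auto
    then show "real l * p l \<le> 2 * (real (l - a) * p l)" by simp
  qed
  also have "\<dots> \<le> (\<Sum>l\<le>N. 2 * (real (l - a) * p l))"
    using N p(1) by (intro sum_mono2) auto
  also have "\<dots> = 2 * (\<Sum>m=a..<N. sum p {..N} - sum p {..m})"
    by (simp add: sum_distrib_left flip: sum_excess_eq)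
  also have "(\<Sum>m=a..<N. sum p {..N} - sum p {..m})
      \<le> (\<Sum>m=a..<N. \<bar>sum p {..m} - sum q {..m}\<bar> + (1 - sum q {..m}))"
  proof (intro sum_mono)
    fix m
    show "sum p {..N} - sum p {..m} \<le> \<bar>sum p {..m} - sum q {..m}\<bar> + (1 - sum q {..m})"
      using p(2)[of N] by linarith
  qed
  also have "\<dots> \<le> e + real a powr (-\<eta>) * C"
    unfolding sum.distrib using q d assms(8,9)
    by (intro add_mono sum_abs_cdf_le sum_cdf_tail_le) auto
  finally show ?thesis by simp
qed

text \<open>Deterministic core, applied with \<open>u\<close> and \<open>v\<close> the rows at
  \<open>k\<close> of the empirical and the limiting joint density, and \<open>p\<close> and
  \<open>q\<close> the size-biased densities that dominate them.\<close>

lemma moment_diff_le: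
  fixes p q u v :: "nat \<Rightarrow> real"
  assumes q: "\<And>l. 0 \<le> q l" "q sums 1" "(\<lambda>l. real l powr (1 + \<eta>) * q l) sums C"
    and p: "\<And>l. 0 \<le> p l" "\<And>N. sum p {..N} \<le> 1"
    and d: "d1 p q \<le> ennreal e" "0 \<le> e"
    and "0 < \<eta>" "1 \<le> a"
    and u: "\<And>l. 0 \<le> u l" "\<And>l. u l \<le> p l"
    and v: "\<And>l. 1 \<le> l \<Longrightarrow> 0 \<le> v l" "\<And>l. 1 \<le> l \<Longrightarrow> v l \<le> q l"
    and s: "\<And>F. finite F \<Longrightarrow> F \<subseteq> {1..} \<Longrightarrow> (\<Sum>l\<in>F. \<bar>u l - v l\<bar>) \<le> s"
    and sv: "(\<lambda>l. v l * real l) summable_on {1..}"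
  shows "\<bar>(\<Sum>\<^sub>\<infinity>l\<in>{1..}. u l * real l) - (\<Sum>\<^sub>\<infinity>l\<in>{1..}. v l * real l)\<bar>
    \<le> 2 * real a * s + 2 * e + 3 * (real a powr (-\<eta>) * C)"
proof -
  define w where "w l = (u l - v l) * real l" for l
  define B where "B = 2 * real a * s + 2 * e + 3 * (real a powr (-\<eta>) * C)"
  have bound: "(\<Sum>l\<in>F. \<bar>w l\<bar>) \<le> B" if F: "finite F" "F \<subseteq> {1..}" for F
  proof -
    \<comment> \<open>On the head the factor \<open>l\<close> is at most \<open>2 * a\<close> and
      the differences sum to at most \<open>s\<close>; on the tail \<open>u\<close> and
      \<open>v\<close> are bounded separately by \<open>p\<close> and \<open>q\<close>.\<close>
    let ?F1 = "F \<inter> {..2 * a}" and ?F2 = "F \<inter> {2 * a<..}"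
    have "(\<Sum>l\<in>F. \<bar>w l\<bar>) = (\<Sum>l\<in>?F1. \<bar>w l\<bar>) + (\<Sum>l\<in>?F2. \<bar>w l\<bar>)"
      using F by (subst sum.union_disjoint[symmetric]) (auto intro!: sum.cong)
    moreover have "(\<Sum>l\<in>?F1. \<bar>w l\<bar>) \<le> 2 * real a * s"
    proof -
      have "(\<Sum>l\<in>?F1. \<bar>w l\<bar>) \<le> (\<Sum>l\<in>?F1. 2 * real a * \<bar>u l - v l\<bar>)"
      proof (intro sum_mono)
        fix l assume "l \<in> ?F1"
        then have "real l \<le> 2 * real a" by auto
        then show "\<bar>w l\<bar> \<le> 2 * real a * \<bar>u l - v l\<bar>"
          unfolding w_def abs_mult by (subst mult.commute) (intro mult_right_mono, auto)
      qed
      also have "\<dots> \<le> 2 * real a * s"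
        unfolding sum_distrib_left[symmetric] using F by (intro mult_left_mono s) auto
      finally show ?thesis .
    qed
    moreover have "(\<Sum>l\<in>?F2. \<bar>w l\<bar>) \<le> 2 * e + 3 * (real a powr (-\<eta>) * C)"
    proof -
      have "(\<Sum>l\<in>?F2. \<bar>w l\<bar>) \<le> (\<Sum>l\<in>?F2. real l * p l + real l * q l)"
      proof (intro sum_mono)
        fix l assume "l \<in> ?F2"
        with F have "1 \<le> l" by auto
        then have "\<bar>u l - v l\<bar> \<le> p l + q l"
          using u[of l] v[of l] by linarith
        then have "\<bar>u l - v l\<bar> * real l \<le> (p l + q l) * real l"
          by (intro mult_right_mono) auto
        then show "\<bar>w l\<bar> \<le> real l * p l + real l * q l"
          unfolding w_def abs_mult by (simp add: distrib_left mult.commute[of _ "real l"])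
      qed
      \<comment> \<open>The cut at \<open>2 * a\<close> is dictated by the bound for
        \<open>p\<close>; for \<open>q\<close> it suffices that \<open>2 * a < l\<close> implies
        \<open>a \<le> l\<close>.\<close>
      also have "\<dots> \<le> 2 * (e + real a powr (-\<eta>) * C) + real a powr (-\<eta>) * C"
        unfolding sum.distrib using F assms(8,9)
        by (intro add_mono sum_tail_le_of_d1[OF q p d] sum_moment_tail_le[OF q(1,3)]) auto
      finally show ?thesis by (simp add: algebra_simps)
    qed
    ultimately show ?thesis by (simp add: B_def)
  qed
  have aw: "(\<lambda>l. norm (w l)) summable_on {1..}"
    using bound by (intro nonneg_bdd_above_summable_on bdd_aboveI[of _ B]) auto
  then have sw: "w summable_on {1..}"
    by (rule abs_summable_summable)
  have "\<bar>infsum w {1..}\<bar> \<le> (\<Sum>\<^sub>\<infinity>l\<in>{1..}. \<bar>w l\<bar>)"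
    using norm_infsum_bound[OF aw] by simp
  also have "\<dots> \<le> B"
    using aw bound by (intro infsum_le_finite_sums) auto
  finally have "\<bar>infsum w {1..}\<bar> \<le> B" .
  \<comment> \<open>A divergent \<open>infsum\<close> is 0 by default, so this splitting relies on
    the summability of both \<open>w\<close> and the \<open>v\<close> series.\<close>
  moreover have "(\<Sum>\<^sub>\<infinity>l\<in>{1..}. u l * real l) = infsum w {1..} + (\<Sum>\<^sub>\<infinity>l\<in>{1..}. v l * real l)"
    unfolding infsum_add[OF sw sv, symmetric] by (simp add: w_def algebra_simps)
  ultimately show ?thesis by (simp add: B_def)
qed

section \<open>Empirical densities of a single graph and the size-biased limit\<close>

lemma arcs_commute: "arcs E i j = arcs E j i"
proof -
  have "Upair i j = Upair j i" by simp
  then show ?thesis by (simp only: arcs_def eq_commute[of i j])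
    (metis (full_types))
qed

lemma emp_deg_sb_nonneg: "0 \<le> emp_deg_sb n E l"
  unfolding emp_deg_sb_def by (intro divide_nonneg_nonneg sum_nonneg) auto

lemma emp_joint_nonneg: "0 \<le> emp_joint n E k l"
  unfolding emp_joint_def by (intro divide_nonneg_nonneg sum_nonneg) auto

text \<open>The weights of all degrees add up to \<open>total_deg n E\<close>. An inequality is the
  right form even for large \<open>N\<close>: if the total degree is 0, the density
  vanishes.\<close>

lemma sum_emp_deg_sb_le: "sum (emp_deg_sb n E) {..N} \<le> 1"
proof -
  have "(\<Sum>l\<le>N. \<Sum>i=1..n. real l * of_bool (deg n E i = l))
      = (\<Sum>i=1..n. \<Sum>l\<le>N. if deg n E i = l then real l else 0)"
    by (subst sum.swap) (auto intro!: sum.cong)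
  also have "\<dots> \<le> (\<Sum>i=1..n. real (deg n E i))"
    by (intro sum_mono) simp
  also have "\<dots> = real (total_deg n E)"
    by (simp add: total_deg_def)
  finally show ?thesis
    unfolding emp_deg_sb_def sum_divide_distrib[symmetric]
    by (intro divide_le_eq_1[THEN iffD2]) linarith
qed

text \<open>Dropping the condition on the starting node leaves all arcs into nodes of degree
  \<open>l\<close>; by symmetry each such node receives exactly \<open>l\<close> arcs.\<close>

lemma emp_joint_le_emp_deg_sb: "emp_joint n E k l \<le> emp_deg_sb n E l"
proof -
  have "(\<Sum>i=1..n. \<Sum>j=1..n. real (arcs E i j) * of_bool (deg n E i = k \<and> deg n E j = l))
      \<le> (\<Sum>i=1..n. \<Sum>j=1..n. real (arcs E i j) * of_bool (deg n E j = l))"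
    by (intro sum_mono) auto
  also have "\<dots> = (\<Sum>j=1..n. (\<Sum>i=1..n. real (arcs E j i)) * of_bool (deg n E j = l))"
    by (subst sum.swap) (simp add: sum_distrib_right arcs_commute)
  also have "\<dots> = (\<Sum>j=1..n. real (deg n E j) * of_bool (deg n E j = l))"
    by (simp add: deg_def)
  also have "\<dots> = (\<Sum>j=1..n. real l * of_bool (deg n E j = l))"
    by (intro sum.cong) auto
  finally show ?thesis
    unfolding emp_joint_def emp_deg_sb_def by (intro divide_right_mono) auto
qed

text \<open>Only the finitely many degrees that occur in the graph contribute.\<close>

lemma emp_joint_summable_on: "(\<lambda>(k, l). emp_joint n E k l) summable_on A"
proof -
  let ?D = "deg n E ` {1..n}"
  have "emp_joint n E k l = 0" if "(k, l) \<notin> ?D \<times> ?D" for k l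
    unfolding emp_joint_def using that by (auto intro!: sum.neutral)
  then have "((\<lambda>(k, l). emp_joint n E k l) summable_on A)
      = ((\<lambda>(k, l). emp_joint n E k l) summable_on (A \<inter> ?D \<times> ?D))"
    by (intro summable_on_cong_neutral) auto
  then show ?thesis by simp
qed

lemma pmf_summable_on: "pmf h summable_on A"
  by (rule nonneg_bdd_above_summable_on)
    (auto intro!: bdd_aboveI[of _ 1] simp: measure_measure_pmf_finite[symmetric])

lemma sum_joint_diff_le:
  assumes jc: "joint_close h \<kappa> n E" and k: "1 \<le> k" "emp_deg n E k > 0"
    and F: "finite F" "F \<subseteq> {1..}"
  shows "(\<Sum>l\<in>F. \<bar>emp_joint n E k l - pmf h (k, l)\<bar>) \<le> real n powr (-\<kappa>)"
proof -
  let ?A = "{1..} \<times> {1..} :: (nat \<times> nat) set"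
  let ?g = "\<lambda>(k, l). \<bar>emp_joint n E k l - pmf h (k, l)\<bar> * of_bool (emp_deg n E k > 0)"
  \<comment> \<open>Summability has to be established: a divergent double series would have
    \<open>infsum\<close> 0, and \<open>joint_close\<close> would then bound nothing.\<close>
  have "(\<lambda>x. (case x of (k, l) \<Rightarrow> emp_joint n E k l) + - pmf h x) summable_on ?A"
    by (intro summable_on_add emp_joint_summable_on summable_on_uminus[THEN iffD2] pmf_summable_on)
  then have "(\<lambda>x. norm ((case x of (k, l) \<Rightarrow> emp_joint n E k l) + - pmf h x)) summable_on ?A"
    by (rule summable_on_iff_abs_summable_on_real[THEN iffD1])
  then have "?g summable_on ?A"
    by (rule summable_on_comparison_test) auto
  then have "sum ?g ({k} \<times> F) \<le> infsum ?g ?A"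
    using F k by (intro finite_sum_le_infsum) auto
  also have "\<dots> \<le> real n powr (-\<kappa>)"
    using jc by (simp add: joint_close_def)
  also have "sum ?g ({k} \<times> F) = (\<Sum>l\<in>F. \<bar>emp_joint n E k l - pmf h (k, l)\<bar>)"
    using k by (simp add: sum.cartesian_product[symmetric])
  finally show ?thesis .
qed

text \<open>Size-biasing shifts moments by one, so the (2 + \<eta>)-moment of \<open>f\<close>
  becomes a (1 + \<eta>)-moment. A \<open>k \<ge> 1\<close> of positive mass makes the mean
  positive, hence the normalisation genuine.\<close>

lemma size_biased_facts:
  fixes f :: "nat pmf"
  assumes mom: "summable (\<lambda>j. real j powr (2 + \<eta>) * pmf f j)" and \<eta>: "0 < \<eta>"
    and k: "1 \<le> k" "pmf f k > 0"
  shows "0 \<le> size_biased (pmf f) l"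
    and "size_biased (pmf f) sums 1"
    and "summable (\<lambda>l. real l powr (1 + \<eta>) * size_biased (pmf f) l)"
    and "size_biased (pmf f) k > 0"
proof -
  define \<mu> where "\<mu> = (\<Sum>j. real j * pmf f j)"
  have sm: "summable (\<lambda>j. real j * pmf f j)"
  proof (rule summable_comparison_test'[OF mom])
    fix j :: nat
    have "real j \<le> real j powr (2 + \<eta>)"
    proof (cases "j = 0")
      case False
      with \<eta> have "real j powr 1 \<le> real j powr (2 + \<eta>)"
        by (intro powr_mono) auto
      with False show ?thesis by simp
    qed simp
    then show "norm (real j * pmf f j) \<le> real j powr (2 + \<eta>) * pmf f j"
      by (auto simp: abs_mult intro!: mult_right_mono)
  qed
  have \<mu>: "0 < \<mu>"
    unfolding \<mu>_def using sm k by (intro suminf_pos2[where i = k]) auto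
  have q: "size_biased (pmf f) l = real l * pmf f l / \<mu>" for l
    by (simp add: size_biased_def \<mu>_def)
  show "0 \<le> size_biased (pmf f) l" "size_biased (pmf f) k > 0"
    using \<mu> k by (simp_all add: q)
  have "(\<lambda>l. real l * pmf f l / \<mu>) sums (\<mu> / \<mu>)"
    using sm unfolding \<mu>_def by (intro sums_divide summable_sums)
  then show "size_biased (pmf f) sums 1"
    using \<mu> by (simp add: q[abs_def])
  have "real l powr (1 + \<eta>) * size_biased (pmf f) l = real l powr (2 + \<eta>) * pmf f l / \<mu>" for l
    by (cases "l = 0") (simp_all add: q powr_add power2_eq_square)
  then show "summable (\<lambda>l. real l powr (1 + \<eta>) * size_biased (pmf f) l)"
    using summable_divide[OF mom, of \<mu>] by simp
qed

section \<open>Comparison of powers and stability of quotients\<close>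

lemma powr_neg_tendsto_0: "0 < s \<Longrightarrow> (\<lambda>n. real n powr (-s)) \<longlonglongrightarrow> 0"
  by (rule tendsto_neg_powr[OF _ filterlim_real_sequentially]) simp

text \<open>After division by \<open>n powr (-d)\<close> both terms still tend to 0; the strict gaps
  between the exponents absorb the constants \<open>A\<close> and \<open>B\<close>.\<close>

lemma eventually_powr_sum_le:
  fixes A B :: real
  assumes "d < s" "d < t"
  shows "\<forall>\<^sub>F n in sequentially. A * real n powr (-s) + B * real n powr (-t) \<le> real n powr (-d)"
proof -
  have "(\<lambda>n. A * real n powr (-(s - d)) + B * real n powr (-(t - d))) \<longlonglongrightarrow> A * 0 + B * 0"
    using assms by (intro tendsto_intros powr_neg_tendsto_0) auto
  then have "\<forall>\<^sub>F n in sequentially. A * real n powr (-(s - d)) + B * real n powr (-(t - d)) < 1"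
    by (rule order_tendstoD) simp
  then show ?thesis
    using eventually_gt_at_top[of 0]
  proof eventually_elim
    case (elim n)
    have "(A * real n powr (-(s - d)) + B * real n powr (-(t - d))) * real n powr (-d)
        \<le> 1 * real n powr (-d)"
      using elim by (intro mult_right_mono) auto
    then show ?case
      by (simp add: distrib_right mult.assoc flip: powr_add)
  qed
qed

text \<open>The error splits into \<open>(A - B) / p\<close> and
  \<open>B * (q - p) / (q * p)\<close>, where \<open>e \<le> q / 2\<close> forces
  \<open>p \<ge> q / 2\<close>.\<close>

lemma quotient_diff_le:
  fixes p q A B D e :: real
  assumes q: "0 < q" and p: "\<bar>p - q\<bar> \<le> e" "e \<le> q / 2" and D: "\<bar>A - B\<bar> \<le> D"
  shows "\<bar>A / p - B / q\<bar> \<le> 2 / q * D + 2 * \<bar>B\<bar> / q\<^sup>2 * e"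
proof -
  have pq: "q / 2 \<le> p" "0 < p" using p q by linarith+
  have inv: "1 / p \<le> 2 / q" using pq q by (simp add: field_simps)
  have "A / p - B / q = (A - B) * (1 / p) + B * (q - p) / q * (1 / p)"
    using pq q by (simp add: field_simps)
  then have "\<bar>A / p - B / q\<bar> \<le> \<bar>(A - B) * (1 / p)\<bar> + \<bar>B * (q - p) / q * (1 / p)\<bar>"
    by linarith
  also have "\<dots> = \<bar>A - B\<bar> * (1 / p) + \<bar>B\<bar> * \<bar>p - q\<bar> / q * (1 / p)"
    using pq q by (simp add: abs_mult abs_minus_commute)
  also have "\<dots> \<le> D * (2 / q) + \<bar>B\<bar> * e / q * (2 / q)"
    using pq q p D inv by (intro add_mono mult_mono divide_right_mono) auto
  also have "\<dots> = 2 / q * D + 2 * \<bar>B\<bar> / q\<^sup>2 * e"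
    by (simp add: power2_eq_square mult_ac)
  finally show ?thesis .
qed

section \<open>Graphs in both events, and the transfer to probabilities\<close>

lemma deg_closeD:
  assumes "deg_close f \<epsilon> n E"
  shows "d1 (emp_deg n E) (pmf f) \<le> ennreal (real n powr (-\<epsilon>))"
    and "d1 (emp_deg_sb n E) (size_biased (pmf f)) \<le> ennreal (real n powr (-\<epsilon>))"
  using assms by (simp_all add: deg_close_def)

text \<open>The deviation from \<open>pmf f k\<close> is smaller than \<open>pmf f k\<close> itself.
  This switches on the indicators in \<open>annd\<close> and \<open>joint_close\<close>.\<close>

lemma emp_deg_pos:
  assumes "deg_close f \<epsilon> n E" "1 \<le> k" "real n powr (-\<epsilon>) < pmf f k"
  shows "emp_deg n E k > 0"
  using density_diff_le[OF deg_closeD(1)[OF assms(1)] _ assms(2)] assms(3) by simp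

text \<open>Squeeze between P(Q) - P(not P) and 1. It reduces limits of probabilities to
  implications between events, and the probability space may change with \<open>n\<close>.\<close>

lemma tendsto_prob_of_bad_bound:
  fixes M :: "nat \<Rightarrow> 'w measure" and P Q R :: "nat \<Rightarrow> 'w \<Rightarrow> bool"
  assumes M: "\<And>n. 1 \<le> n \<Longrightarrow> prob_space (M n)"
    and meas: "\<And>n. 1 \<le> n \<Longrightarrow> Measurable.pred (M n) (P n)" "\<And>n. 1 \<le> n \<Longrightarrow> Measurable.pred (M n) (Q n)"
      "\<And>n. 1 \<le> n \<Longrightarrow> Measurable.pred (M n) (R n)"
    and P: "(\<lambda>n. measure (M n) {\<omega> \<in> space (M n). \<not> P n \<omega>}) \<longlonglongrightarrow> 0"
    and Q: "(\<lambda>n. measure (M n) {\<omega> \<in> space (M n). Q n \<omega>}) \<longlonglongrightarrow> 1"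
    and R: "\<forall>\<^sub>F n in sequentially. \<forall>\<omega>\<in>space (M n). P n \<omega> \<longrightarrow> Q n \<omega> \<longrightarrow> R n \<omega>"
  shows "(\<lambda>n. measure (M n) {\<omega> \<in> space (M n). R n \<omega>}) \<longlonglongrightarrow> 1"
proof (rule tendsto_sandwich)
  show "(\<lambda>n. measure (M n) {\<omega> \<in> space (M n). Q n \<omega>} - measure (M n) {\<omega> \<in> space (M n). \<not> P n \<omega>}) \<longlonglongrightarrow> 1"
    using tendsto_diff[OF Q P] by simp
  show "(\<lambda>n. 1) \<longlonglongrightarrow> (1 :: real)" by simp
  show "\<forall>\<^sub>F n in sequentially. measure (M n) {\<omega> \<in> space (M n). R n \<omega>} \<le> 1"
    using eventually_ge_at_top[of 1] by eventually_elim (simp add: prob_space.prob_le_1 M)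
  show "\<forall>\<^sub>F n in sequentially. measure (M n) {\<omega> \<in> space (M n). Q n \<omega>}
      - measure (M n) {\<omega> \<in> space (M n). \<not> P n \<omega>} \<le> measure (M n) {\<omega> \<in> space (M n). R n \<omega>}"
    using R eventually_ge_at_top[of 1]
  proof eventually_elim
    case (elim n)
    interpret prob_space "M n" using M elim by simp
    note [measurable] = meas[OF elim(2)]
    have "measure (M n) {\<omega> \<in> space (M n). Q n \<omega>}
        \<le> measure (M n) ({\<omega> \<in> space (M n). R n \<omega>} \<union> {\<omega> \<in> space (M n). \<not> P n \<omega>})"
      using elim(1) by (intro finite_measure_mono) auto
    also have "\<dots> \<le> measure (M n) {\<omega> \<in> space (M n). R n \<omega>} + measure (M n) {\<omega> \<in> space (M n). \<not> P n \<omega>}"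
      by (intro measure_subadditive) auto
    finally show ?case by simp
  qed
qed

text \<open>Both sides are deterministic, so one graph in both events for each large
  \<open>n\<close> is enough: there \<open>h\<close> is within \<open>n powr (-\<kappa>)\<close> of
  the empirical joint density, and the dominating empirical density is within
  \<open>n powr (-\<epsilon>)\<close> of its limit.\<close>

lemma pmf_joint_le_size_biased:
  assumes good: "\<forall>\<^sub>F n in sequentially. \<exists>E. deg_close f \<epsilon> n E \<and> joint_close h \<kappa> n E"
    and "0 < \<epsilon>" "0 < \<kappa>" and k: "1 \<le> k" "pmf f k > 0" and l: "1 \<le> l"
  shows "pmf h (k, l) \<le> size_biased (pmf f) l"
proof (rule tendsto_lowerbound)
  let ?q = "size_biased (pmf f)"
  have "(\<lambda>n. ?q l + (real n powr (-\<epsilon>) + real n powr (-\<kappa>))) \<longlonglongrightarrow> ?q l + (0 + 0)"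
    using assms by (intro tendsto_intros powr_neg_tendsto_0)
  then show "(\<lambda>n. ?q l + (real n powr (-\<epsilon>) + real n powr (-\<kappa>))) \<longlonglongrightarrow> ?q l"
    by simp
  have "\<forall>\<^sub>F n in sequentially. real n powr (-\<epsilon>) < pmf f k"
    using powr_neg_tendsto_0[OF \<open>0 < \<epsilon>\<close>] k by (intro order_tendstoD)
  with good show "\<forall>\<^sub>F n in sequentially. pmf h (k, l) \<le> ?q l + (real n powr (-\<epsilon>) + real n powr (-\<kappa>))"
  proof eventually_elim
    case (elim n)
    then obtain E where E: "deg_close f \<epsilon> n E" "joint_close h \<kappa> n E"
      by blast
    have "(\<Sum>l\<in>{l}. \<bar>emp_joint n E k l - pmf h (k, l)\<bar>) \<le> real n powr (-\<kappa>)"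
      using elim k l E by (intro sum_joint_diff_le emp_deg_pos) auto
    moreover have "\<bar>emp_deg_sb n E l - ?q l\<bar> \<le> real n powr (-\<epsilon>)"
      using l by (intro density_diff_le deg_closeD[OF E(1)]) auto
    ultimately show ?case
      using emp_joint_le_emp_deg_sb[of n E k l] by simp
  qed
qed simp

text \<open>Non-asymptotic estimate for a single graph: \<open>moment_diff_le\<close> controls the
  numerators, \<open>density_diff_le\<close> the denominators, and \<open>quotient_diff_le\<close>
  combines them.\<close>

lemma annd_diff_le:
  fixes f :: "nat pmf" and h :: "(nat \<times> nat) pmf"
  defines "q \<equiv> size_biased (pmf f)"
  assumes q: "\<And>l. 0 \<le> q l" "q sums 1" "(\<lambda>l. real l powr (1 + \<eta>) * q l) sums C" "0 < q k"
    and hq: "\<And>l. 1 \<le> l \<Longrightarrow> pmf h (k, l) \<le> q l"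
    and sv: "(\<lambda>l. pmf h (k, l) * real l) summable_on {1..}"
    and B: "B = (\<Sum>\<^sub>\<infinity>l\<in>{1..}. pmf h (k, l) * real l)"
    and \<eta>: "0 < \<eta>" and \<kappa>: "0 < \<kappa>" and k: "1 \<le> k" and n: "1 \<le> n"
    and E: "deg_close f \<epsilon> n E" "joint_close h \<kappa> n E"
    and large: "real n powr (-\<epsilon>) < pmf f k" "real n powr (-\<epsilon>) \<le> q k / 2"
  shows "\<bar>annd n E k - limit_annd f h k\<bar>
    \<le> 2 / q k * ((4 + 3 * C) * real n powr (-(\<kappa> * \<eta> / (\<eta> + 1))) + 2 * real n powr (-\<epsilon>))
      + 2 * \<bar>B\<bar> / (q k)\<^sup>2 * real n powr (-\<epsilon>)"
proof -
  define x where "x = real n powr (\<kappa> / (\<eta> + 1))"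
  define a where "a = nat \<lceil>x\<rceil>"
  let ?r = "real n powr (-(\<kappa> * \<eta> / (\<eta> + 1)))"
  have x: "1 \<le> x"
    unfolding x_def using n \<eta> \<kappa> by (intro ge_one_powr_ge_zero) auto
  \<comment> \<open>Rounding up costs at most a factor 2 because \<open>x \<ge> 1\<close>; this
    produces the constant 4 in the bound.\<close>
  have a: "x \<le> real a" "real a \<le> 2 * x" "1 \<le> a"
    using x unfolding a_def by linarith+
  have pos: "emp_deg n E k > 0"
    using emp_deg_pos[OF E(1) k large(1)] .
  have C: "0 \<le> C"
    using q by (intro sums_le[OF _ sums_zero q(3)]) simp
  have "\<bar>(\<Sum>\<^sub>\<infinity>l\<in>{1..}. emp_joint n E k l * real l) - B\<bar>
      \<le> 2 * real a * real n powr (-\<kappa>) + 2 * real n powr (-\<epsilon>) + 3 * (real a powr (-\<eta>) * C)"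
    unfolding B using a k \<eta> pos q(1-3) hq sv
    by (intro moment_diff_le[where p = "emp_deg_sb n E" and q = q] sum_joint_diff_le[OF E(2)]
        emp_deg_sb_nonneg sum_emp_deg_sb_le emp_joint_nonneg emp_joint_le_emp_deg_sb
        deg_closeD(2)[OF E(1), folded q_def]) auto
  also have "\<dots> \<le> (4 + 3 * C) * ?r + 2 * real n powr (-\<epsilon>)"
  proof -
    have "\<kappa> / (\<eta> + 1) - \<kappa> = -(\<kappa> * \<eta> / (\<eta> + 1))"
      using \<eta> by (simp add: field_simps)
    then have "x * real n powr (-\<kappa>) = ?r"
      by (simp add: x_def flip: powr_add)
    moreover have "real a * real n powr (-\<kappa>) \<le> (2 * x) * real n powr (-\<kappa>)"
      using a by (intro mult_right_mono) auto
    ultimately have 1: "2 * real a * real n powr (-\<kappa>) \<le> 4 * ?r" by simp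
    have "real a powr (-\<eta>) \<le> x powr (-\<eta>)"
      using a x \<eta> by (intro powr_mono2') auto
    also have "\<dots> = ?r"
      by (simp add: x_def powr_powr)
    finally have 2: "real a powr (-\<eta>) * C \<le> ?r * C"
      using C by (rule mult_right_mono)
    from 1 2 show ?thesis by (simp add: algebra_simps)
  qed
  finally have num: "\<bar>(\<Sum>\<^sub>\<infinity>l\<in>{1..}. emp_joint n E k l * real l) - B\<bar>
      \<le> (4 + 3 * C) * ?r + 2 * real n powr (-\<epsilon>)" .
  have den: "\<bar>emp_deg_sb n E k - q k\<bar> \<le> real n powr (-\<epsilon>)"
    unfolding q_def using k by (intro density_diff_le deg_closeD[OF E(1)]) auto
  have "annd n E k = (\<Sum>\<^sub>\<infinity>l\<in>{1..}. emp_joint n E k l * real l) / emp_deg_sb n E k"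
    using pos by (simp add: annd_def)
  moreover have "limit_annd f h k = B / q k"
    using q(4) by (simp add: limit_annd_def B q_def)
  ultimately show ?thesis
    using quotient_diff_le[OF q(4) den large(2) num] by simp
qed

theorem theorem4p2:
  fixes M :: "nat \<Rightarrow> 'w measure"
    and G :: "nat \<Rightarrow> 'w \<Rightarrow> multigraph"
    and f :: "nat pmf" and h :: "(nat \<times> nat) pmf"
    and \<alpha> \<epsilon> \<kappa> \<eta> \<delta> :: real and k :: nat
  assumes "\<And>n. n \<ge> 1 \<Longrightarrow> prob_space (M n)"
    and "\<And>n. n \<ge> 1 \<Longrightarrow> G n \<in> measurable (M n) (count_space UNIV)"
    and "\<And>n \<omega>. n \<ge> 1 \<Longrightarrow> \<omega> \<in> space (M n) \<Longrightarrow> multigraph_on n (G n \<omega>)"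
    and "\<alpha> > 0" and "\<epsilon> > 0"
    and "(\<lambda>n. measure (M n) {\<omega> \<in> space (M n). \<not> deg_close f \<epsilon> n (G n \<omega>)})
           \<in> O(\<lambda>n. real n powr (- \<alpha>))"
    and "set_pmf h \<subseteq> {1..} \<times> {1..}"
    and "\<kappa> > 0"
    and "(\<lambda>n. measure (M n) {\<omega> \<in> space (M n). joint_close h \<kappa> n (G n \<omega>)})
           \<longlonglongrightarrow> 1"
    and "0 < \<eta>" and "\<eta> < 1"
    and "summable (\<lambda>j. real j powr (2 + \<eta>) * pmf f j)"
    and "pmf f k > 0"
    and "0 < \<delta>" and "\<delta> < min \<epsilon> (\<kappa> * \<eta> / (\<eta> + 1))"
  shows "(\<lambda>l. pmf h (k, l) * real l) summable_on {1..} \<and>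
         (\<lambda>n. measure (M n)
            {\<omega> \<in> space (M n). \<bar>annd n (G n \<omega>) k - limit_annd f h k\<bar> \<le> real n powr (- \<delta>)})
           \<longlonglongrightarrow> 1"
proof -
  \<comment> \<open>\<open>G n\<close> is measurable into a discrete space, so every property of the
    graph defines an event.\<close>
  have meas: "Measurable.pred (M n) (\<lambda>\<omega>. P (G n \<omega>))" if "1 \<le> n" for n P
    using measurable_compose[OF assms(2)[OF that], of P "count_space UNIV"] by simp
  have "(\<lambda>n. real n powr (-\<alpha>)) \<in> o(\<lambda>_. 1)"
    using powr_neg_tendsto_0[OF \<open>\<alpha> > 0\<close>] by (intro smalloI_tendsto) auto
  from smalloD_tendsto[OF landau_o.big_small_trans[OF assms(6) this]]
  have bad: "(\<lambda>n. measure (M n) {\<omega> \<in> space (M n). \<not> deg_close f \<epsilon> n (G n \<omega>)}) \<longlonglongrightarrow> 0"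
    by simp
  note prob_tendsto = tendsto_prob_of_bad_bound[OF assms(1) meas meas meas bad assms(9)]
  show ?thesis
  proof (cases "k = 0")
    \<comment> \<open>Both quantities are 0 here: the size-biased densities vanish at 0, so
      \<open>annd\<close> is a division by 0 and the indicator in \<open>limit_annd\<close> is off.
      The row of \<open>h\<close> at 0 is zero since \<open>h\<close> lives on positive
      integers.\<close>
    case True
    have "(0, l) \<notin> set_pmf h" for l
      using assms(7) by auto
    then have "pmf h (k, l) = 0" for l
      by (simp add: True pmf_eq_0_set_pmf)
    then have "(\<lambda>l. pmf h (k, l) * real l) summable_on {1..}"
      by simp
    moreover have "\<bar>annd n E k - limit_annd f h k\<bar> \<le> real n powr (-\<delta>)" for n E
      by (simp add: True annd_def limit_annd_def size_biased_def emp_deg_sb_def)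
    then have "(\<lambda>n. measure (M n)
        {\<omega> \<in> space (M n). \<bar>annd n (G n \<omega>) k - limit_annd f h k\<bar> \<le> real n powr (-\<delta>)}) \<longlonglongrightarrow> 1"
      by (intro prob_tendsto always_eventually allI ballI impI)
    ultimately show ?thesis ..
  next
    case False
    then have k: "1 \<le> k" by simp
    define q where "q = size_biased (pmf f)"
    note q = size_biased_facts[OF assms(12,10) k assms(13), folded q_def]
    define C where "C = (\<Sum>l. real l powr (1 + \<eta>) * q l)"
    have C: "(\<lambda>l. real l powr (1 + \<eta>) * q l) sums C"
      unfolding C_def using q(3) by (rule summable_sums)
    \<comment> \<open>An event whose probability tends to 1 is eventually nonempty, and any of its
      outcomes supplies the graph.\<close>
    have good: "\<forall>\<^sub>F n in sequentially. \<exists>E. deg_close f \<epsilon> n E \<and> joint_close h \<kappa> n E"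
    proof -
      have "(\<lambda>n. measure (M n) {\<omega> \<in> space (M n). deg_close f \<epsilon> n (G n \<omega>) \<and> joint_close h \<kappa> n (G n \<omega>)}) \<longlonglongrightarrow> 1"
        by (rule prob_tendsto) auto
      then have "\<forall>\<^sub>F n in sequentially. 0 < measure (M n)
          {\<omega> \<in> space (M n). deg_close f \<epsilon> n (G n \<omega>) \<and> joint_close h \<kappa> n (G n \<omega>)}"
        by (rule order_tendstoD) simp
      then show ?thesis
      proof eventually_elim
        case (elim n)
        then have "{\<omega> \<in> space (M n). deg_close f \<epsilon> n (G n \<omega>) \<and> joint_close h \<kappa> n (G n \<omega>)} \<noteq> {}"
          by (metis less_irrefl measure_empty)
        then show ?case by blast
      qed
    qed
    have hq: "pmf h (k, l) \<le> q l" if "1 \<le> l" for l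
      unfolding q_def using good assms(5,8) k assms(13) that by (rule pmf_joint_le_size_biased)
    \<comment> \<open>Domination by \<open>q\<close> bounds every finite partial sum by the moment
      \<open>C\<close>, through the tail estimate with \<open>a = 1\<close>.\<close>
    have sv: "(\<lambda>l. pmf h (k, l) * real l) summable_on {1..}"
    proof (rule nonneg_bdd_above_summable_on)
      have "(\<Sum>l\<in>F. pmf h (k, l) * real l) \<le> C" if F: "finite F" "F \<subseteq> {1..}" for F
      proof -
        have "(\<Sum>l\<in>F. pmf h (k, l) * real l) \<le> (\<Sum>l\<in>F. real l * q l)"
          using F hq by (intro sum_mono) (auto simp: mult.commute intro!: mult_left_mono)
        also have "\<dots> \<le> real 1 powr (-\<eta>) * C"
          using F C q assms(10) by (intro sum_moment_tail_le) auto
        finally show ?thesis by simp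
      qed
      then show "bdd_above (sum (\<lambda>l. pmf h (k, l) * real l) ` {F. F \<subseteq> {1..} \<and> finite F})"
        by (intro bdd_aboveI[of _ C]) auto
    qed auto
    define B where "B = (\<Sum>\<^sub>\<infinity>l\<in>{1..}. pmf h (k, l) * real l)"
    \<comment> \<open>\<open>K\<close> and \<open>K'\<close> collect the coefficients of the two
      powers of \<open>n\<close> in \<open>annd_diff_le\<close>.\<close>
    define K where "K = 2 / q k * (4 + 3 * C)"
    define K' where "K' = 4 / q k + 2 * \<bar>B\<bar> / (q k)\<^sup>2"
    have e0: "(\<lambda>n. real n powr (-\<epsilon>)) \<longlonglongrightarrow> 0"
      using assms(5) by (rule powr_neg_tendsto_0)
    have "\<forall>\<^sub>F n in sequentially. real n powr (-\<epsilon>) < pmf f k"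
      using e0 assms(13) by (rule order_tendstoD)
    moreover have "\<forall>\<^sub>F n in sequentially. real n powr (-\<epsilon>) < q k / 2"
      using e0 q(4) by (intro order_tendstoD) auto
    moreover have "\<forall>\<^sub>F n in sequentially.
        K * real n powr (-(\<kappa> * \<eta> / (\<eta> + 1))) + K' * real n powr (-\<epsilon>) \<le> real n powr (-\<delta>)"
      using assms(15) by (intro eventually_powr_sum_le) auto
    ultimately have "\<forall>\<^sub>F n in sequentially. \<forall>\<omega>\<in>space (M n). deg_close f \<epsilon> n (G n \<omega>) \<longrightarrow>
        joint_close h \<kappa> n (G n \<omega>) \<longrightarrow> \<bar>annd n (G n \<omega>) k - limit_annd f h k\<bar> \<le> real n powr (-\<delta>)"
      using eventually_ge_at_top[of 1]
    proof eventually_elim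
      case (elim n)
      have "\<bar>annd n E k - limit_annd f h k\<bar> \<le> real n powr (-\<delta>)"
        if E: "deg_close f \<epsilon> n E" "joint_close h \<kappa> n E" for E
      proof -
        have "\<bar>annd n E k - limit_annd f h k\<bar>
            \<le> 2 / q k * ((4 + 3 * C) * real n powr (-(\<kappa> * \<eta> / (\<eta> + 1))) + 2 * real n powr (-\<epsilon>))
              + 2 * \<bar>B\<bar> / (q k)\<^sup>2 * real n powr (-\<epsilon>)"
          unfolding q_def using q C hq sv elim k assms(8,10) E
          by (intro annd_diff_le) (auto simp: B_def q_def)
        also have "\<dots> = K * real n powr (-(\<kappa> * \<eta> / (\<eta> + 1))) + K' * real n powr (-\<epsilon>)"
          by (simp add: K_def K'_def algebra_simps)
        finally show ?thesis using elim by simp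
      qed
      then show ?case by blast
    qed
    then have "(\<lambda>n. measure (M n)
        {\<omega> \<in> space (M n). \<bar>annd n (G n \<omega>) k - limit_annd f h k\<bar> \<le> real n powr (-\<delta>)}) \<longlonglongrightarrow> 1"
      by (intro prob_tendsto)
    with sv show ?thesis ..
  qed
qed

end
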